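(* Let $(\mathcal{H},\mathcal{X})$ be a problem with $n=|\mathcal{H}|$ hypotheses. If the problem is $\frac{1}{\alpha}$-split-neighborly and has a coherence parameter of $c$, then Generalized Binary Search has a worst-case query cost of at most $$\frac{\log_2 n}{-\log_2(1-\beta)},\qquad\text{where}\qquad \beta=\min\left(c,\frac{1}{\frac{1}{\alpha}+2}\right).$$
   Context: Problem: a nonempty finite set $\mathcal{H}$ of $n$ hypotheses and a set $\mathcal{X}$ of tests, where each $h\in\mathcal{H}$ is a function $\mathcal{X}\to\{0,1\}$. Hypotheses are identifiable: any two distinct hypotheses give different results on at least one test. For a nonempty finite set $V$, $\mathbb{E}_{h\in V}[f(h)]=\frac{1}{|V|}\sum_{h\in V}f(h)$. Coherence parameter: the largest $c$ such that for some (discrete) probability distribution $P$ on $\mathcal{X}$, $\mathbb{E}_{x\sim P}[h(x)]\in[c,1-c]$ for all $h\in\mathcal{H}$. Split-neighborly: for tests $x,x'$ let $\Delta(x,x')=\{h\in\mathcal{H}: h(x)=0 \wedge h(x')=1\}$. For $\alpha\in(0,\frac12]$, define a directed graph on $\mathcal{X}$ with a directed edge $(x,x')$ iff for every $V\subseteq\Delta(x,x')$, either $|V|\le 1$ or there exists a test $\hat x\in\mathcal{X}$ with $\mathbb{E}_{h\in V}[h(\hat x)]\in[\alpha,1-\alpha]$. The problem is $\frac1\alpha$-split-neighborly if this graph is strongly connected. As a special case ($\alpha=1$), the problem is $1$-split-neighborly if the directed graph with an edge $(x,x')$ whenever $|\Delta(x,x')|\le1$ is strongly connected. Generalized Binary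 Search (GBS): there is an unknown $h^*\in\mathcal{H}$. Start with $V=\mathcal{H}$. While $|V|>1$: choose a test $x\in\mathcal{X}$ minimizing $|\mathbb{E}_{h\in V}[h(x)]-\frac12|$ (ties broken arbitrarily), observe $y=h^*(x)$, and replace $V$ by $\{h\in V: h(x)=y\}$. The worst-case query cost is the maximum over $h^*\in\mathcal{H}$ of the number of queries made until $|V|=1$. If $\beta=0$ the bound is read as $+\infty$. *)

theory Defs
  imports
    "HOL-Probability.Probability_Mass_Function"
    "HOL-Library.Extended_Nat"
    "Graph_Theory.Digraph_Component"
begin

text \<open>
  Tests are the elements of a set \<open>X\<close>, which need not be finite. A hypothesis is a function
  \<open>h :: 'x \<Rightarrow> real\<close> taking the values 0 and 1 on \<open>X\<close>; the clause on identifiability makes distinct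
  elements of \<open>H\<close> distinct as functions on \<open>X\<close>.
\<close>

definition learning_problem :: "'x set \<Rightarrow> ('x \<Rightarrow> real) set \<Rightarrow> bool" where
  "learning_problem X H \<longleftrightarrow>
     finite H \<and> H \<noteq> {} \<and>
     (\<forall>h\<in>H. \<forall>x\<in>X. h x \<in> {0, 1}) \<and>
     (\<forall>h\<in>H. \<forall>h'\<in>H. h \<noteq> h' \<longrightarrow> (\<exists>x\<in>X. h x \<noteq> h' x))"

definition avg :: "('x \<Rightarrow> real) set \<Rightarrow> 'x \<Rightarrow> real" where
  "avg V x = (\<Sum>h\<in>V. h x) / real (card V)"


definition coherent :: "'x set \<Rightarrow> ('x \<Rightarrow> real) set \<Rightarrow> real \<Rightarrow> bool" where
  "coherent X H c \<longleftrightarrow>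
     (\<exists>P :: 'x pmf. set_pmf P \<subseteq> X \<and>
        (\<forall>h\<in>H. measure_pmf.expectation P h \<in> {c..1 - c}))"

definition coherence_parameter :: "'x set \<Rightarrow> ('x \<Rightarrow> real) set \<Rightarrow> real \<Rightarrow> bool" where
  "coherence_parameter X H c \<longleftrightarrow> coherent X H c \<and> (\<forall>c'. coherent X H c' \<longrightarrow> c' \<le> c)"


definition \<Delta> :: "('x \<Rightarrow> real) set \<Rightarrow> 'x \<Rightarrow> 'x \<Rightarrow> ('x \<Rightarrow> real) set" where
  "\<Delta> H x x' = {h\<in>H. h x = 0 \<and> h x' = 1}"

definition split_edge ::
    "'x set \<Rightarrow> ('x \<Rightarrow> real) set \<Rightarrow> real \<Rightarrow> 'x \<Rightarrow> 'x \<Rightarrow> bool" where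
  "split_edge X H \<alpha> x x' \<longleftrightarrow>
     (\<forall>V \<subseteq> \<Delta> H x x'. card V \<le> 1 \<or> (\<exists>z\<in>X. avg V z \<in> {\<alpha>..1 - \<alpha>}))"

definition digraph_on :: "'x set \<Rightarrow> ('x \<Rightarrow> 'x \<Rightarrow> bool) \<Rightarrow> ('x, 'x \<times> 'x) pre_digraph" where
  "digraph_on X E = \<lparr>verts = X, arcs = {(x, x') \<in> X \<times> X. E x x'}, tail = fst, head = snd\<rparr>"

definition split_neighborly :: "'x set \<Rightarrow> ('x \<Rightarrow> real) set \<Rightarrow> real \<Rightarrow> bool" where
  "split_neighborly X H k \<longleftrightarrow>
     (\<exists>\<alpha>. 0 < \<alpha> \<and> \<alpha> \<le> 1 / 2 \<and> k = 1 / \<alpha> \<and>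
        strongly_connected (digraph_on X (split_edge X H \<alpha>))) \<or>
     (k = 1 \<and> strongly_connected (digraph_on X (\<lambda>x x'. card (\<Delta> H x x') \<le> 1)))"


text \<open>
  An execution of Generalized Binary Search with target \<open>h\<close> is represented by an infinite sequence
  \<open>xs\<close> of tests, of which only the tests up to the point where the version space becomes a
  singleton are constrained and counted. Quantifying over all sequences accounts for every way of
  breaking ties, and an execution that never stops has cost \<open>\<infinity>\<close>.
\<close>

primrec version_space ::
    "('x \<Rightarrow> real) set \<Rightarrow> ('x \<Rightarrow> real) \<Rightarrow> (nat \<Rightarrow> 'x) \<Rightarrow> nat \<Rightarrow> ('x \<Rightarrow> real) set" where
  "version_space H h xs 0 = H"
| "version_space H h xs (Suc t) = {g \<in> version_space H h xs t. g (xs t) = h (xs t)}"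

definition gbs_run ::
    "'x set \<Rightarrow> ('x \<Rightarrow> real) set \<Rightarrow> ('x \<Rightarrow> real) \<Rightarrow> (nat \<Rightarrow> 'x) \<Rightarrow> bool" where
  "gbs_run X H h xs \<longleftrightarrow>
     (\<forall>t. card (version_space H h xs t) > 1 \<longrightarrow>
        is_arg_min (\<lambda>x. \<bar>avg (version_space H h xs t) x - 1 / 2\<bar>) (\<lambda>x. x \<in> X) (xs t))"

definition query_cost :: "('x \<Rightarrow> real) set \<Rightarrow> ('x \<Rightarrow> real) \<Rightarrow> (nat \<Rightarrow> 'x) \<Rightarrow> enat" where
  "query_cost H h xs = (INF t \<in> {t. card (version_space H h xs t) = 1}. enat t)"

definition gbs_worst_case_cost :: "'x set \<Rightarrow> ('x \<Rightarrow> real) set \<Rightarrow> enat" where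
  "gbs_worst_case_cost X H = (SUP h\<in>H. SUP xs\<in>{xs. gbs_run X H h xs}. query_cost H h xs)"

end

theory Submission
  imports Defs
begin

text \<open>
  Every version space \<open>V\<close> with at least two elements admits a test whose average over \<open>V\<close> lies in
  \<open>[\<beta>, 1 - \<beta>]\<close>. Otherwise each test is either low (average below \<open>\<beta>\<close>) or high (average above
  \<open>1 - \<beta>\<close>). By coherence both kinds occur, since averaging over the coherent distribution gives a
  value in \<open>[c, 1 - c]\<close>, so strong connectivity yields an edge from a low test \<open>x\<close> to a high test
  \<open>x'\<close>. All but a fraction \<open>2\<beta>\<close> of \<open>V\<close> then lies in \<open>\<Delta> x x'\<close>, and a test splitting that part with
  ratio \<open>\<alpha>\<close> splits \<open>V\<close> with ratio at least \<open>\<alpha> (1 - 2\<beta>) \<ge> \<beta>\<close>, a contradiction. That part has at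
  least two elements, since \<open>\<beta> \<le> 1/4\<close> for \<open>\<alpha> \<le> 1/2\<close>; for \<open>\<alpha> = 1\<close> one has \<open>\<beta> \<le> 1/3\<close>, and only
  \<open>card V = 2\<close> remains, where identifiability gives an even split. Hence each query of GBS
  shrinks the version space by a factor of at most \<open>1 - \<beta>\<close>.
\<close>

section \<open>Cut arcs and elementary facts about learning problems\<close>

text \<open>A path from \<open>u\<close> to \<open>v\<close> starts inside \<open>P\<close> and ends
  outside it, so one of its arcs leaves \<open>P\<close>.\<close>

lemma strongly_connected_cut_edge:
  assumes "strongly_connected (digraph_on X E)"
    and "u \<in> X" "v \<in> X" "P u" "\<not> P v"
  obtains x x' where "x \<in> X" "x' \<in> X" "E x x'" "P x" "\<not> P x'"
proof -
  have "(u, v) \<in> (arcs_ends (digraph_on X E))\<^sup>*"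
    using assms by (auto simp: strongly_connected_def digraph_on_def intro!: reachable_rtranclI)
  then have "\<exists>x x'. (x, x') \<in> arcs_ends (digraph_on X E) \<and> P x \<and> \<not> P x'"
    using assms(4,5) by (induction rule: rtrancl_induct) blast+
  then show thesis
    using that by (auto simp: arcs_ends_def arc_to_ends_def digraph_on_def)
qed

lemma learning_problem_finite:
  assumes "learning_problem X H" "V \<subseteq> H"
  shows "finite V"
  using assms by (simp add: learning_problem_def finite_subset)

lemma learning_problem_binary:
  assumes "learning_problem X H" "h \<in> H" "x \<in> X"
  shows "h x = 0 \<or> h x = 1"
  using assms by (simp add: learning_problem_def)

section \<open>Coherent distributions\<close>

text \<open>By linearity, the expectation of \<open>avg V\<close> is the mean over \<open>V\<close>
  of the individual expectations, each in \<open>[c, 1 - c]\<close>. A random variable cannot stay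
  almost surely strictly on one side of a bound that its expectation respects.\<close>

lemma coherent_balanced_on_average:
  assumes "learning_problem X H" "coherent X H c" "V \<subseteq> H" "V \<noteq> {}"
  obtains u v where "u \<in> X" "v \<in> X" "c \<le> avg V u" "avg V v \<le> 1 - c"
proof -
  obtain P :: "'a pmf" where P: "set_pmf P \<subseteq> X"
    and E: "\<And>h. h \<in> H \<Longrightarrow> measure_pmf.expectation P h \<in> {c..1 - c}"
    using assms(2) unfolding coherent_def by blast
  have fin: "finite V"
    by (rule learning_problem_finite[OF assms(1,3)])
  then have card: "real (card V) > 0"
    using assms(4) by (simp add: card_gt_0_iff)
  have int: "integrable (measure_pmf P) h" if "h \<in> V" for h
  proof (rule measure_pmf.integrable_const_bound[where B = 1])
    show "AE x in measure_pmf P. norm (h x) \<le> 1"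
      unfolding AE_measure_pmf_iff
    proof
      fix x assume "x \<in> set_pmf P"
      then have "h x = 0 \<or> h x = 1"
        using learning_problem_binary[OF assms(1)] assms(3) P that by blast
      then show "norm (h x) \<le> 1" by auto
    qed
  qed simp
  have int_avg: "integrable (measure_pmf P) (avg V)"
    unfolding avg_def using int by auto
  have "measure_pmf.expectation P (avg V)
      = (\<Sum>h\<in>V. measure_pmf.expectation P h) / real (card V)"
    unfolding avg_def using int by simp
  moreover have "(\<Sum>h\<in>V. measure_pmf.expectation P h) \<ge> real (card V) * c"
    using E assms(3) by (intro sum_bounded_below) auto
  moreover have "(\<Sum>h\<in>V. measure_pmf.expectation P h) \<le> real (card V) * (1 - c)"
    using E assms(3) by (intro sum_bounded_above) auto
  ultimately have bounds: "c \<le> measure_pmf.expectation P (avg V)"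
      "measure_pmf.expectation P (avg V) \<le> 1 - c"
    using card by (simp_all add: pos_le_divide_eq pos_divide_le_eq mult.commute)
  have "\<exists>u\<in>X. c \<le> avg V u"
  proof (rule ccontr)
    assume "\<not> ?thesis"
    then have "AE x in measure_pmf P. avg V x < c"
      using P by (force simp: AE_measure_pmf_iff not_le)
    from measure_pmf.expectation_less[OF int_avg this] show False
      using bounds by simp
  qed
  moreover have "\<exists>v\<in>X. avg V v \<le> 1 - c"
  proof (rule ccontr)
    assume "\<not> ?thesis"
    then have "AE x in measure_pmf P. 1 - c < avg V x"
      using P by (force simp: AE_measure_pmf_iff not_le)
    from measure_pmf.expectation_greater[OF int_avg this] show False
      using bounds by simp
  qed
  ultimately show thesis using that by blast
qed

lemma coherent_le_half:
  assumes "learning_problem X H" "coherent X H c"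
  shows "c \<le> 1 / 2"
proof -
  have "\<exists>h. h \<in> H" using assms(1) by (auto simp: learning_problem_def)
  then have "\<exists>a. c \<le> a \<and> a \<le> 1 - c"
    using assms(2) by (fastforce simp: coherent_def)
  then show ?thesis by auto
qed

text \<open>A point mass at any single test witnesses coherence 0, and \<open>c\<close> is
  maximal.\<close>

lemma coherence_parameter_nonneg:
  assumes "learning_problem X H" "X \<noteq> {}" "coherence_parameter X H c"
  shows "0 \<le> c"
proof -
  obtain x where "x \<in> X" using assms(2) by blast
  have "h x \<in> {0..1 - 0}" if "h \<in> H" for h
    using learning_problem_binary[OF assms(1) that \<open>x \<in> X\<close>] by auto
  then have "coherent X H 0"
    using \<open>x \<in> X\<close> unfolding coherent_def by (intro exI[of _ "return_pmf x"]) simp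
  then show ?thesis using assms(3) by (simp add: coherence_parameter_def)
qed

section \<open>Existence of balanced tests\<close>

lemma pair_balanced_test:
  assumes "learning_problem X H" "V \<subseteq> H" "card V = 2"
  obtains x where "x \<in> X" "avg V x = 1 / 2"
proof -
  obtain g h where V: "V = {g, h}" "g \<noteq> h" using assms(3) by (auto simp: card_2_iff)
  then obtain x where x: "x \<in> X" "g x \<noteq> h x"
    using assms(1,2) unfolding learning_problem_def by blast
  moreover have "g x = 0 \<or> g x = 1" "h x = 0 \<or> h x = 1"
    using learning_problem_binary[OF assms(1) _ x(1)] assms(2) V(1) by auto
  ultimately have "avg V x = 1 / 2" using V by (auto simp: avg_def)
  with x show thesis using that by blast
qed

text \<open>The difference \<open>h x' - h x\<close> is 1 on \<open>\<Delta> H x x'\<close> and at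
  most 0 on the rest of \<open>H\<close>, so its sum over \<open>V\<close> bounds the count from
  below, while the two averages differ by more than \<open>1 - 2 * \<beta>\<close>.\<close>

lemma card_\<Delta>_gt:
  fixes \<beta> :: real
  assumes "learning_problem X H" "V \<subseteq> H" "V \<noteq> {}" "x \<in> X" "x' \<in> X"
    and "avg V x < \<beta>" "1 - \<beta> < avg V x'"
  shows "(1 - 2 * \<beta>) * card V < card (V \<inter> \<Delta> H x x')"
proof -
  have fin: "finite V"
    by (rule learning_problem_finite[OF assms(1,2)])
  then have card: "real (card V) > 0"
    using assms(3) by (simp add: card_gt_0_iff)
  have "(1 - 2 * \<beta>) * card V < (\<Sum>h\<in>V. h x') - (\<Sum>h\<in>V. h x)"
    using assms(6,7) card unfolding avg_def by (simp add: field_simps)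
  also have "\<dots> = (\<Sum>h\<in>V. h x' - h x)"
    by (simp add: sum_subtractf)
  also have "\<dots> \<le> (\<Sum>h\<in>V. if h \<in> \<Delta> H x x' then 1 else 0)"
  proof (rule sum_mono)
    fix h assume "h \<in> V"
    then have "h \<in> H" using assms(2) by blast
    moreover from this have "h x = 0 \<or> h x = 1" "h x' = 0 \<or> h x' = 1"
      using learning_problem_binary[OF assms(1)] assms(4,5) by blast+
    ultimately show "h x' - h x \<le> (if h \<in> \<Delta> H x x' then 1 else 0)"
      by (auto simp: \<Delta>_def)
  qed
  also have "\<dots> = card (V \<inter> \<Delta> H x x')"
    using fin by (simp add: sum.If_cases Int_def)
  finally show ?thesis .
qed

text \<open>\<open>W\<close> supplies at least \<open>\<alpha> * card W\<close> ones and as many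
  zeros at \<open>z\<close>; enlarging \<open>W\<close> to \<open>V\<close> loses none of them. The
  zeros are counted by summing \<open>1 - h z\<close>.\<close>

lemma avg_balanced_superset:
  fixes \<alpha> \<beta> :: real
  assumes "learning_problem X H" "V \<subseteq> H" "W \<subseteq> V" "W \<noteq> {}" "z \<in> X"
    and "avg W z \<in> {\<alpha>..1 - \<alpha>}" "\<beta> * card V \<le> \<alpha> * card W"
  shows "avg V z \<in> {\<beta>..1 - \<beta>}"
proof -
  have fin: "finite V"
    by (rule learning_problem_finite[OF assms(1,2)])
  have pos: "real (card W) > 0" "real (card V) > 0"
    using fin assms(3,4) finite_subset[OF assms(3) fin] by (auto simp: card_gt_0_iff)
  have bin: "0 \<le> h z \<and> h z \<le> 1" if "h \<in> V" for h
    using learning_problem_binary[OF assms(1) _ assms(5), of h] assms(2) that by fastforce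
  have "(\<Sum>h\<in>W. h z) \<le> (\<Sum>h\<in>V. h z)"
    using fin assms(3) bin by (intro sum_mono2) auto
  moreover have "(\<Sum>h\<in>W. 1 - h z) \<le> (\<Sum>h\<in>V. 1 - h z)"
    using fin assms(3) bin by (intro sum_mono2) auto
  ultimately show ?thesis
    using assms(6,7) pos unfolding avg_def by (simp add: sum_subtractf field_simps)
qed

lemma exists_balanced_test:
  assumes lp: "learning_problem X H" and sn: "split_neighborly X H (1 / \<alpha>)"
    and co: "coherent X H c" and \<beta>: "\<beta> = min c (1 / (1 / \<alpha> + 2))"
    and V: "V \<subseteq> H" "card V > 1"
  obtains x where "x \<in> X" "avg V x \<in> {\<beta>..1 - \<beta>}"
proof (rule ccontr)
  assume "\<not> thesis"
  with that have unbal: "avg V x < \<beta> \<or> 1 - \<beta> < avg V x" if "x \<in> X" for x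
    using that by force
  have half: "\<beta> \<le> 1 / 2" and "\<beta> \<le> c"
    using coherent_le_half[OF lp co] \<beta> by auto
  have ne: "V \<noteq> {}" using V by auto
  obtain u v where "u \<in> X" "v \<in> X" "c \<le> avg V u" "avg V v \<le> 1 - c"
    using coherent_balanced_on_average[OF lp co V(1) ne] .
  then have uv: "v \<in> X" "u \<in> X" "avg V v < \<beta>" "\<not> avg V u < \<beta>"
    using unbal[of v] \<open>\<beta> \<le> c\<close> by auto
  \<comment> \<open>Kept general in \<open>E\<close> to serve both kinds of graph; the cut separates
    the low tests from the high ones.\<close>
  have cut: "\<exists>x\<in>X. \<exists>x'\<in>X. E x x' \<and> (1 - 2 * \<beta>) * card V < card (V \<inter> \<Delta> H x x')"
    if sc: "strongly_connected (digraph_on X E)" for E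
  proof -
    obtain x x' where "x \<in> X" "x' \<in> X" "E x x'" "avg V x < \<beta>" "\<not> avg V x' < \<beta>"
      by (rule strongly_connected_cut_edge[OF sc, of v u "\<lambda>x. avg V x < \<beta>"]) (use uv in auto)
    then show ?thesis
      using card_\<Delta>_gt[OF lp V(1) ne] unbal by blast
  qed
  \<comment> \<open>Injectivity of the reciprocal identifies the witness in
    \<open>split_neighborly\<close> with the given \<open>\<alpha>\<close>, and turns
    \<open>1 / \<alpha> = 1\<close> into \<open>\<alpha> = 1\<close>.\<close>
  consider (neighborly) "0 < \<alpha>" "\<alpha> \<le> 1 / 2" "strongly_connected (digraph_on X (split_edge X H \<alpha>))"
    | (one) "\<alpha> = 1" "strongly_connected (digraph_on X (\<lambda>x x'. card (\<Delta> H x x') \<le> 1))"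
    using sn unfolding split_neighborly_def by (auto simp: field_simps)
  then show False
  proof cases
    case neighborly
    \<comment> \<open>This constant is the solution of
      \<open>\<beta> = \<alpha> * (1 - 2 * \<beta>)\<close>, the break-even point for passing from
      the split part back to \<open>V\<close>.\<close>
    have "1 / (1 / \<alpha> + 2) = \<alpha> / (1 + 2 * \<alpha>)"
      using neighborly(1) by (simp add: field_simps)
    with \<beta> have "\<beta> \<le> \<alpha> / (1 + 2 * \<alpha>)" by simp
    then have \<beta>_le: "\<beta> \<le> \<alpha> * (1 - 2 * \<beta>)"
      using neighborly(1) by (simp add: field_simps)
    have "\<alpha> * (1 - 2 * \<beta>) \<le> 1 / 2 * (1 - 2 * \<beta>)"
      using neighborly(2) half by (intro mult_right_mono) auto
    with \<beta>_le have quarter: "\<beta> \<le> 1 / 4" by simp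
    obtain x x' where edge: "split_edge X H \<alpha> x x'"
      and W: "(1 - 2 * \<beta>) * card V < card (V \<inter> \<Delta> H x x')" (is "_ < real (card ?W)")
      using cut[OF neighborly(3)] by blast
    \<comment> \<open>The product is at least 1 and \<open>W\<close> is strictly larger, so the edge
      condition cannot be met by its trivial alternative.\<close>
    have "1 / 2 * 2 \<le> (1 - 2 * \<beta>) * card V"
      using quarter V(2) by (intro mult_mono) auto
    with W have "card ?W > 1" by simp
    with edge obtain z where z: "z \<in> X" "avg ?W z \<in> {\<alpha>..1 - \<alpha>}"
      unfolding split_edge_def by (metis inf_le2 not_le)
    have "\<beta> * card V \<le> \<alpha> * (1 - 2 * \<beta>) * card V"
      using \<beta>_le by (intro mult_right_mono) auto
    also have "\<dots> \<le> \<alpha> * card ?W"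
      using W neighborly(1) by simp
    finally have "avg V z \<in> {\<beta>..1 - \<beta>}"
      using \<open>card ?W > 1\<close> z by (intro avg_balanced_superset[OF lp V(1)]) auto
    with unbal[OF z(1)] show False by auto
  next
    case one
    then have third: "\<beta> \<le> 1 / 3" using \<beta> by simp
    obtain x x' where "card (\<Delta> H x x') \<le> 1"
      and W: "(1 - 2 * \<beta>) * card V < card (V \<inter> \<Delta> H x x')"
      using cut[OF one(2)] by blast
    moreover have "finite (\<Delta> H x x')"
      using lp by (simp add: learning_problem_def \<Delta>_def)
    ultimately have "card (V \<inter> \<Delta> H x x') \<le> 1"
      by (meson card_mono inf_le2 le_trans)
    with W have small: "(1 - 2 * \<beta>) * card V < 1" by linarith
    \<comment> \<open>Together with \<open>small\<close> this forces
      \<open>card V < 3\<close>.\<close>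
    have "1 / 3 * real (card V) \<le> (1 - 2 * \<beta>) * card V"
      using third by (intro mult_right_mono) auto
    with small V(2) have "card V = 2" by linarith
    then obtain z where "z \<in> X" "avg V z = 1 / 2"
      using pair_balanced_test[OF lp V(1)] by blast
    with unbal half show False by force
  qed
qed

section \<open>Shrinking of version spaces along a run\<close>

text \<open>The survivors are counted by the sum of \<open>g x\<close> when the answer is 1 and of
  \<open>1 - g x\<close> when it is 0; balance bounds both sums.\<close>

lemma card_answer_le:
  fixes \<beta> :: real
  assumes "learning_problem X H" "V \<subseteq> H" "h \<in> H" "x \<in> X" "V \<noteq> {}"
    and "avg V x \<in> {\<beta>..1 - \<beta>}"
  shows "real (card {g \<in> V. g x = h x}) \<le> (1 - \<beta>) * card V"
proof -
  have fin: "finite V"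
    by (rule learning_problem_finite[OF assms(1,2)])
  then have pos: "real (card V) > 0"
    using assms(5) by (simp add: card_gt_0_iff)
  have bin: "g x = 0 \<or> g x = 1" if "g \<in> H" for g
    using learning_problem_binary[OF assms(1) that assms(4)] .
  have "real (card {g \<in> V. g x = h x}) = (\<Sum>g\<in>V. if g x = h x then 1 else 0)"
    using fin by (simp add: sum.If_cases Int_def)
  also have "\<dots> = (\<Sum>g\<in>V. if h x = 1 then g x else 1 - g x)"
  proof (rule sum.cong)
    fix g assume "g \<in> V"
    then show "(if g x = h x then 1 else 0) = (if h x = 1 then g x else 1 - g x)"
      using bin[of g] bin[OF assms(3)] assms(2) by auto
  qed simp
  also have "\<dots> \<le> (1 - \<beta>) * card V"
    using assms(6) pos by (cases "h x = 1") (auto simp: avg_def sum_subtractf field_simps)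
  finally show ?thesis .
qed

lemma version_space_subset: "version_space H h xs t \<subseteq> H"
  by (induction t) auto

lemma target_in_version_space: "h \<in> H \<Longrightarrow> h \<in> version_space H h xs t"
  by (induction t) auto

lemma card_version_space_le:
  fixes \<beta> :: real
  assumes lp: "learning_problem X H" and h: "h \<in> H" and run: "gbs_run X H h xs"
    and \<beta>: "\<beta> \<le> 1"
    and bal: "\<And>V. V \<subseteq> H \<Longrightarrow> card V > 1 \<Longrightarrow> \<exists>x\<in>X. avg V x \<in> {\<beta>..1 - \<beta>}"
    and big: "\<And>s. s < t \<Longrightarrow> card (version_space H h xs s) > 1"
  shows "real (card (version_space H h xs t)) \<le> card H * (1 - \<beta>) ^ t"
  using big
proof (induction t)
  case (Suc t)
  let ?V = "version_space H h xs t"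
  have V: "card ?V > 1" using Suc.prems by simp
  then have am: "is_arg_min (\<lambda>x. \<bar>avg ?V x - 1 / 2\<bar>) (\<lambda>x. x \<in> X) (xs t)"
    using run by (simp add: gbs_run_def)
  obtain x where x: "x \<in> X" "avg ?V x \<in> {\<beta>..1 - \<beta>}"
    using bal[OF version_space_subset V] by blast
  have mem: "xs t \<in> X" using am by (simp add: is_arg_min_def)
  \<comment> \<open>The greedy test is at least as close to 1/2 as the balanced test
    \<open>x\<close>, and \<open>[\<beta>, 1 - \<beta>]\<close> is symmetric about 1/2, so the
    greedy test is balanced too.\<close>
  have "\<bar>avg ?V (xs t) - 1 / 2\<bar> \<le> \<bar>avg ?V x - 1 / 2\<bar>"
    using am x(1) by (simp add: is_arg_min_def not_less)
  also have "\<bar>avg ?V x - 1 / 2\<bar> \<le> 1 / 2 - \<beta>"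
    using x(2) by (auto simp: abs_le_iff)
  finally have "avg ?V (xs t) \<in> {\<beta>..1 - \<beta>}" by (simp add: abs_le_iff)
  then have "real (card {g \<in> ?V. g (xs t) = h (xs t)}) \<le> (1 - \<beta>) * card ?V"
    using V mem h by (intro card_answer_le[OF lp version_space_subset]) auto
  also have "\<dots> \<le> (1 - \<beta>) * (card H * (1 - \<beta>) ^ t)"
    using Suc \<beta> by (intro mult_left_mono) auto
  finally show ?case by (simp add: mult_ac)
qed simp

text \<open>The target always survives, so \<open>1 \<le> card H * (1 - \<beta>) ^ t\<close> up to
  the first singleton; taking logarithms bounds \<open>t\<close>.\<close>

lemma query_cost_le:
  fixes \<beta> :: real
  assumes lp: "learning_problem X H" and h: "h \<in> H" and run: "gbs_run X H h xs"
    and \<beta>: "0 < \<beta>" "\<beta> < 1"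
    and bal: "\<And>V. V \<subseteq> H \<Longrightarrow> card V > 1 \<Longrightarrow> \<exists>x\<in>X. avg V x \<in> {\<beta>..1 - \<beta>}"
  obtains t where "query_cost H h xs \<le> enat t"
    and "real t \<le> log 2 (card H) / (- log 2 (1 - \<beta>))"
proof -
  let ?V = "version_space H h xs"
  have fin: "finite H" using lp by (simp add: learning_problem_def)
  have ge1: "card (?V t) \<ge> 1" for t
  proof -
    have "finite (?V t)" by (rule learning_problem_finite[OF lp version_space_subset])
    moreover have "?V t \<noteq> {}" using target_in_version_space[OF h, of xs t] by auto
    ultimately show ?thesis by (simp add: Suc_le_eq card_gt_0_iff)
  qed
  have le: "real (card (?V t)) \<le> card H * (1 - \<beta>) ^ t" if "\<And>s. s < t \<Longrightarrow> card (?V s) \<noteq> 1" for t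
  proof -
    have "card (?V s) > 1" if "s < t" for s
      using \<open>\<And>s. s < t \<Longrightarrow> card (?V s) \<noteq> 1\<close>[OF that] ge1[of s] by simp
    then show ?thesis
      using \<beta> by (intro card_version_space_le[OF lp h run _ bal]) auto
  qed
  \<comment> \<open>Geometric decay rules out an endless run, so the least index below is
    attained.\<close>
  have "\<exists>t. card (?V t) = 1"
  proof (rule ccontr)
    assume "\<not> ?thesis"
    then have "1 \<le> card H * (1 - \<beta>) ^ t" for t
      using le[of t] ge1[of t] by simp
    moreover have "(\<lambda>t. card H * (1 - \<beta>) ^ t) \<longlonglongrightarrow> real (card H) * 0"
      using \<beta> by (intro tendsto_mult tendsto_const LIMSEQ_realpow_zero) auto
    ultimately show False
      using LIMSEQ_le_const[of "\<lambda>t. card H * (1 - \<beta>) ^ t" "real (card H) * 0" 1] by auto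
  qed
  define t where "t = (LEAST t. card (?V t) = 1)"
  have t: "card (?V t) = 1"
    unfolding t_def using \<open>\<exists>t. card (?V t) = 1\<close> by (rule LeastI_ex)
  \<comment> \<open>By minimality no earlier version space is a singleton, so \<open>le\<close>
    still applies at \<open>t\<close> itself.\<close>
  have "1 \<le> card H * (1 - \<beta>) ^ t"
    using le[of t] t not_less_Least unfolding t_def by fastforce
  then have "log 2 1 \<le> log 2 (card H * (1 - \<beta>) ^ t)"
    by (subst log_le_cancel_iff) auto
  also have "\<dots> = log 2 (card H) + t * log 2 (1 - \<beta>)"
    using \<beta> fin h by (subst log_mult) (auto simp: log_nat_power)
  finally have "t * (- log 2 (1 - \<beta>)) \<le> log 2 (card H)" by simp
  moreover have "- log 2 (1 - \<beta>) > 0" using \<beta> by simp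
  ultimately have "real t \<le> log 2 (card H) / (- log 2 (1 - \<beta>))"
    by (subst pos_le_divide_eq)
  moreover have "query_cost H h xs \<le> enat t"
    unfolding query_cost_def using t by (intro INF_lower) simp
  ultimately show thesis using that by blast
qed

section \<open>Passage to the worst case\<close>

theorem theorem3p2:
  fixes X :: "'x set" and H :: "('x \<Rightarrow> real) set" and \<alpha> c \<beta> :: real and n :: nat
  assumes "learning_problem X H"
    and "n = card H"
    and "split_neighborly X H (1 / \<alpha>)"
    and "coherence_parameter X H c"
    and "\<beta> = min c (1 / (1 / \<alpha> + 2))"
  shows "ereal_of_enat (gbs_worst_case_cost X H)
           \<le> (if \<beta> = 0 then \<infinity> else ereal (log 2 (real n) / (- log 2 (1 - \<beta>))))"
proof (cases "\<beta> = 0")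
  case False
  let ?B = "log 2 (real n) / (- log 2 (1 - \<beta>))"
  have co: "coherent X H c" using assms(4) by (simp add: coherence_parameter_def)
  \<comment> \<open>Strong connectivity includes having at least one vertex.\<close>
  have "X \<noteq> {}"
    using assms(3) by (auto simp: split_neighborly_def strongly_connected_def digraph_on_def)
  then have c: "0 \<le> c" using coherence_parameter_nonneg assms(1,4) by blast
  have "0 < 1 / \<alpha>"
    using assms(3) unfolding split_neighborly_def by auto
  then have "0 < 1 / (1 / \<alpha> + 2)" by (simp add: add_pos_pos)
  with c have \<beta>: "0 < \<beta>" "\<beta> < 1"
    using False assms(5) coherent_le_half[OF assms(1) co] by linarith+
  have "1 \<le> n"
    using assms(1,2) by (simp add: learning_problem_def Suc_le_eq card_gt_0_iff)
  then have B: "0 \<le> ?B" using \<beta> by (intro divide_nonneg_nonneg) auto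
  \<comment> \<open>Costs are integral, so the floor of the real bound is a uniform bound in
    \<open>enat\<close>; the suprema can be taken there before converting to
    \<open>ereal\<close>.\<close>
  have "query_cost H h xs \<le> enat (nat \<lfloor>?B\<rfloor>)" if run: "h \<in> H" "gbs_run X H h xs" for h xs
  proof -
    obtain t where "query_cost H h xs \<le> enat t" "real t \<le> ?B"
      using query_cost_le[OF assms(1) run \<beta>] exists_balanced_test[OF assms(1,3) co assms(5)]
        assms(2) by metis
    moreover from this have "t \<le> nat \<lfloor>?B\<rfloor>" by (simp add: le_nat_floor)
    ultimately show ?thesis by (meson enat_ord_simps(1) order_trans)
  qed
  then have "gbs_worst_case_cost X H \<le> enat (nat \<lfloor>?B\<rfloor>)"
    unfolding gbs_worst_case_cost_def by (intro SUP_least) auto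
  then have "ereal_of_enat (gbs_worst_case_cost X H) \<le> ereal_of_enat (enat (nat \<lfloor>?B\<rfloor>))"
    by (subst ereal_of_enat_le_iff)
  also have "\<dots> \<le> ereal ?B" using B by simp
  finally show ?thesis using False by simp
qed simp

end
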